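(* Let $\mathscr M$ be a complex inner product space and $T:\mathscr M\to\mathscr M$ a linear operator. Suppose that, for $j=1,2$, $T$ admits a Jordan block at a vector $h_j\in\mathscr M$ with eigenvalue $z_j\in\mathbb T$, and that $z_1\neq z_2$. Then the following conditions are equivalent: (i) $\mathscr C_T(h_1)\perp\mathscr C_T(h_2)$; (ii) either $z_1=-z_2$ and there is $(\epsilon_1,\epsilon_2)\in\{-1,1\}\times\{-\mathrm i,\mathrm i\}$ such that $\|T^n(\epsilon_kT^jh_1+h_2)\|^2$ is a polynomial in $n$ for $k=1,2$ and every $j\in\mathbb Z_+$, or $z_1\neq-z_2$ and $\|T^n(T^jh_1+h_2)\|^2$ is a polynomial in $n$ for every $j\in\mathbb Z_+$; (iii) $\|T^n(g_1+h_2)\|^2$ is a polynomial in $n$ for every $g_1\in\mathscr C_T(h_1)$; (iv) $\|T^n(g_1+g_2)\|^2$ is a polynomial in $n$ for all $g_1\in\mathscr C_T(h_1)$ and $g_2\in\mathscr C_T(h_2)$; (v) there is $m\in\mathbb N$ such that the restriction $T|_{\mathscr C_T(h_1)+\mathscr C_T(h_2)}$ is an $m$-isometry.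
   Context: $\mathbb T=\{z\in\mathbb C:|z|=1\}$, $\mathbb N$ is the set of positive integers, $\mathbb Z_+$ the set of nonnegative integers. $\mathscr M$ need not be complete and $T$ need not be bounded. $\mathscr C_T(h)$ denotes the linear span of $\{T^nh:n\in\mathbb Z_+\}$. For $h\in\mathscr M\setminus\{0\}$ and $z\in\mathbb C$, $T$ admits a Jordan block $J$ at $h$ with eigenvalue $z$ if $J=T|_{\mathscr C_T(h)}$ and $J-zI_{\mathscr C_T(h)}$ is nilpotent (equivalently, $h\neq0$ and $(T-zI)^kh=0$ for some $k\in\mathbb N$). A complex sequence $\{\gamma_n\}_{n=0}^\infty$ is a polynomial in $n$ if there is $p\in\mathbb C[x]$ with $\gamma_n=p(n)$ for all $n\in\mathbb Z_+$. A linear operator $S$ on an inner product space $\mathscr N$ is an $m$-isometry ($m\in\mathbb N$) if $\sum_{k=0}^m(-1)^k\binom mk\|S^kh\|^2=0$ for all $h\in\mathscr N$. *)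

theory Defs
  imports
    "HOL-Analysis.Inner_Product"
    "HOL-Library.Set_Algebras"
    "HOL-Computational_Algebra.Polynomial"
begin

text \<open>
  Complex inner product spaces (not assumed complete), with the inner product linear in the first
  and conjugate-linear in the second argument. The class extends \<open>real_inner\<close>: the real structure
  is tied to the complex one by \<open>scaleR_scaleC\<close> and \<open>inner_eq_Re_cinner\<close>, and so carries no extra
  data. Since \<open>cinner x x\<close> is real, positive definiteness of \<open>cinner\<close> is that of \<open>inner\<close>; see
  \<open>cinner_self\<close> and \<open>cinner_eq_zero_iff\<close>.
\<close>

class complex_inner = real_inner +
  fixes scaleC :: "complex \<Rightarrow> 'a \<Rightarrow> 'a"  (infixr \<open>*\<^sub>C\<close> 75)
    and cinner :: "'a \<Rightarrow> 'a \<Rightarrow> complex"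
  assumes scaleC_add_right: "a *\<^sub>C (x + y) = a *\<^sub>C x + a *\<^sub>C y"
    and scaleC_add_left: "(a + b) *\<^sub>C x = a *\<^sub>C x + b *\<^sub>C x"
    and scaleC_scaleC: "a *\<^sub>C b *\<^sub>C x = (a * b) *\<^sub>C x"
    and scaleC_one: "1 *\<^sub>C x = x"
    and cinner_commute: "cinner x y = cnj (cinner y x)"
    and cinner_add_left: "cinner (x + y) w = cinner x w + cinner y w"
    and cinner_scaleC_left: "cinner (a *\<^sub>C x) y = a * cinner x y"
    and scaleR_scaleC: "r *\<^sub>R x = complex_of_real r *\<^sub>C x"
    and inner_eq_Re_cinner: "inner x y = Re (cinner x y)"

lemma cinner_self: "cinner x x = complex_of_real ((norm x)\<^sup>2)"
proof -
  have "Im (cinner x x) = - Im (cinner x x)"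
    by (metis cinner_commute cnj.sel(2))
  then show ?thesis
    by (simp add: complex_eq_iff power2_norm_eq_inner inner_eq_Re_cinner)
qed

lemma cinner_eq_zero_iff: "cinner x x = 0 \<longleftrightarrow> x = 0"
  by (simp add: cinner_self)

global_interpretation complex_vector: vector_space "scaleC :: complex \<Rightarrow> 'a \<Rightarrow> 'a::complex_inner"
  defines cspan = complex_vector.span
  by unfold_locales (fact scaleC_add_right scaleC_add_left scaleC_scaleC scaleC_one)+

instantiation complex :: complex_inner
begin

definition scaleC_complex :: "complex \<Rightarrow> complex \<Rightarrow> complex"
  where "scaleC_complex a x = a * x"

definition cinner_complex :: "complex \<Rightarrow> complex \<Rightarrow> complex"
  where "cinner_complex x y = x * cnj y"

instance
  by standard
    (auto simp: scaleC_complex_def cinner_complex_def algebra_simps inner_complex_def scaleR_conv_of_real)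

end

abbreviation clinear :: "('a::complex_inner \<Rightarrow> 'b::complex_inner) \<Rightarrow> bool"
  where "clinear \<equiv> Vector_Spaces.linear scaleC scaleC"

definition corthogonal :: "'a::complex_inner set \<Rightarrow> 'a set \<Rightarrow> bool"
  where "corthogonal A B \<longleftrightarrow> (\<forall>x\<in>A. \<forall>y\<in>B. cinner x y = 0)"

definition cyclic_space :: "('a::complex_inner \<Rightarrow> 'a) \<Rightarrow> 'a \<Rightarrow> 'a set"
  where "cyclic_space T h = cspan (range (\<lambda>n. (T ^^ n) h))"

text \<open>
  The restriction of an operator \<open>S\<close> to an \<open>S\<close>-invariant subspace \<open>N\<close> is represented by the pair
  of \<open>S\<close> and \<open>N\<close>. The lemmas \<open>cyclic_space_invariant\<close> and \<open>cyclic_space_plus_invariant\<close> show that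
  the subspaces to which this is applied are indeed invariant.
\<close>

definition nilpotent_on :: "'a set \<Rightarrow> ('a::complex_inner \<Rightarrow> 'a) \<Rightarrow> bool"
  where "nilpotent_on N S \<longleftrightarrow> (\<exists>k\<ge>1. \<forall>x\<in>N. (S ^^ k) x = 0)"

definition m_isometry_on :: "nat \<Rightarrow> 'a set \<Rightarrow> ('a::complex_inner \<Rightarrow> 'a) \<Rightarrow> bool"
  where "m_isometry_on m N S \<longleftrightarrow>
    (\<forall>h\<in>N. (\<Sum>k\<le>m. (-1) ^ k * real (m choose k) * (norm ((S ^^ k) h))\<^sup>2) = 0)"

definition admits_jordan_block :: "('a::complex_inner \<Rightarrow> 'a) \<Rightarrow> 'a \<Rightarrow> complex \<Rightarrow> bool"
  where "admits_jordan_block T h z \<longleftrightarrow>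
    h \<noteq> 0 \<and> nilpotent_on (cyclic_space T h) (\<lambda>x. T x - z *\<^sub>C x)"

definition polynomial_seq :: "(nat \<Rightarrow> complex) \<Rightarrow> bool"
  where "polynomial_seq \<gamma> \<longleftrightarrow> (\<exists>p :: complex poly. \<forall>n. \<gamma> n = poly p (of_nat n))"

lemma cyclic_space_invariant:
  assumes "clinear T" and "x \<in> cyclic_space T h"
  shows "T x \<in> cyclic_space T h"
proof -
  interpret T: Vector_Spaces.linear scaleC scaleC T by fact
  have "T ` cyclic_space T h = cspan (T ` range (\<lambda>n. (T ^^ n) h))"
    by (simp add: cyclic_space_def cspan_def T.span_image)
  moreover have "T ` range (\<lambda>n. (T ^^ n) h) \<subseteq> range (\<lambda>n. (T ^^ n) h)"
    by (auto intro: range_eqI[where x = "Suc n" for n])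
  ultimately have "T ` cyclic_space T h \<subseteq> cyclic_space T h"
    unfolding cyclic_space_def by (metis complex_vector.span_mono)
  with assms(2) show ?thesis by blast
qed

lemma cyclic_space_plus_invariant:
  assumes "clinear T" and "x \<in> cyclic_space T h\<^sub>1 + cyclic_space T h\<^sub>2"
  shows "T x \<in> cyclic_space T h\<^sub>1 + cyclic_space T h\<^sub>2"
proof -
  interpret T: Vector_Spaces.linear scaleC scaleC T by fact
  from assms(2) obtain a b where "x = a + b" "a \<in> cyclic_space T h\<^sub>1" "b \<in> cyclic_space T h\<^sub>2"
    by (rule set_plus_elim)
  then show ?thesis
    using cyclic_space_invariant[OF assms(1)] by (auto simp: T.add intro: set_plus_intro)
qed

end

theory Submission
  imports Defs
begin

text \<open>
  On a Jordan block with eigenvalue \<open>z\<close>, \<open>T ^ n\<close> acts as \<open>z ^ n\<close> times a polynomial in \<open>n\<close>. So, for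
  \<open>g\<^sub>1\<close> and \<open>g\<^sub>2\<close> in the two cyclic spaces, \<open>\<parallel>T ^ n (g\<^sub>1 + g\<^sub>2)\<parallel>\<^sup>2\<close> is a polynomial in \<open>n\<close> plus
  \<open>2 Re (w ^ n q n)\<close>, where \<open>w = z\<^sub>1 cnj z\<^sub>2 \<noteq> 1\<close> is unimodular and the polynomial \<open>q\<close> comes from the
  cross term. By linear independence of exponential polynomials, this is a polynomial only if \<open>q = 0\<close>
  when \<open>1\<close>, \<open>w\<close>, \<open>cnj w\<close> are distinct, and only if \<open>Re q = 0\<close> when \<open>w = -1\<close>, in which case the
  factors \<open>\<epsilon>\<^sub>1\<close> and \<open>\<epsilon>\<^sub>2\<close> recover the real and imaginary parts. An \<open>m\<close>-isometry is an operator for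
  which the \<open>m\<close>-th forward difference of every \<open>\<parallel>T ^ n x\<parallel>\<^sup>2\<close> vanishes.
\<close>

section \<open>Forward differences and Newton's formula\<close>

definition fdiff :: "(nat \<Rightarrow> 'a::comm_ring_1) \<Rightarrow> nat \<Rightarrow> 'a"
  where "fdiff f = (\<lambda>n. f (Suc n) - f n)"

lemma fdiff_funpow_zero: "(fdiff ^^ m) (\<lambda>_. 0) = (\<lambda>_. 0)"
  by (induction m) (auto simp: fdiff_def)

lemma fdiff_funpow_add:
  "(fdiff ^^ m) (\<lambda>n. f n + g n) = (\<lambda>n. (fdiff ^^ m) f n + (fdiff ^^ m) g n)"
  by (induction m) (auto simp: fdiff_def)

lemma fdiff_funpow_cmult: "(fdiff ^^ m) (\<lambda>n. c * f n) = (\<lambda>n. c * (fdiff ^^ m) f n)"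
  by (induction m) (auto simp: fdiff_def algebra_simps)

lemma fdiff_funpow_shift: "(fdiff ^^ m) (\<lambda>k. f (n + k)) = (\<lambda>k. (fdiff ^^ m) f (n + k))"
  by (induction m) (auto simp: fdiff_def)

lemma fdiff_funpow_eq_0_mono:
  assumes "(fdiff ^^ m) f = (\<lambda>_. 0)" and "m \<le> k"
  shows "(fdiff ^^ k) f = (\<lambda>_. 0)"
proof -
  have "(fdiff ^^ (k - m + m)) f = (\<lambda>_. 0)"
    unfolding funpow_add by (simp add: assms(1) fdiff_funpow_zero)
  with assms(2) show ?thesis by simp
qed

text \<open>Pascal's rule summed against a sequence; it drives the inductions for both binomial
  formulas below.\<close>

lemma sum_binomial_Suc:
  fixes a :: "nat \<Rightarrow> 'a::comm_ring_1"
  shows "(\<Sum>k\<le>Suc m. of_nat (Suc m choose k) * a k)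
    = (\<Sum>k\<le>m. of_nat (m choose k) * a k) + (\<Sum>k\<le>m. of_nat (m choose k) * a (Suc k))"
proof -
  have "(\<Sum>k\<le>m. of_nat (m choose k) * a k) = (\<Sum>k\<le>Suc m. of_nat (m choose k) * a k)"
    by (simp add: binomial_eq_0)
  also have "\<dots> = a 0 + (\<Sum>k\<le>m. of_nat (m choose Suc k) * a (Suc k))"
    by (subst sum.atMost_Suc_shift) simp
  finally show ?thesis
    by (subst sum.atMost_Suc_shift) (simp add: sum.distrib algebra_simps)
qed

text \<open>Binomial expansion of the shift as identity plus \<open>fdiff\<close>; the induction
  uses the hypothesis for \<open>f\<close> and for \<open>fdiff f\<close>.\<close>

lemma newton_forward: "f n = (\<Sum>k\<le>n. of_nat (n choose k) * (fdiff ^^ k) f 0)"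
proof (induction n arbitrary: f)
  case (Suc n)
  have "f (Suc n) = f n + fdiff f n"
    by (simp add: fdiff_def)
  also have "\<dots> = (\<Sum>k\<le>n. of_nat (n choose k) * (fdiff ^^ k) f 0)
      + (\<Sum>k\<le>n. of_nat (n choose k) * (fdiff ^^ Suc k) f 0)"
    using Suc.IH[of f] Suc.IH[of "fdiff f"] by (simp add: funpow_swap1)
  finally show ?case
    by (simp only: sum_binomial_Suc)
qed simp

text \<open>Binomial expansion of \<open>fdiff\<close> as shift minus identity. The sign
  \<open>(-1) ^ m\<close> is pulled out so that the sum has the form of the one in
  \<open>m_isometry_on\<close>.\<close>

lemma fdiff_funpow_sum:
  "(fdiff ^^ m) f n = (-1) ^ m * (\<Sum>k\<le>m. of_nat (m choose k) * ((-1) ^ k * f (n + k)))"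
proof (induction m arbitrary: f)
  case (Suc m)
  have "(fdiff ^^ Suc m) f n = (fdiff ^^ m) (fdiff f) n"
    by (simp add: funpow_swap1)
  also have "\<dots> = (-1) ^ Suc m * ((\<Sum>k\<le>m. of_nat (m choose k) * ((-1) ^ k * f (n + k)))
      + (\<Sum>k\<le>m. of_nat (m choose k) * ((-1) ^ Suc k * f (n + Suc k))))"
    by (subst Suc.IH) (simp add: fdiff_def algebra_simps sum_subtractf sum_negf)
  finally show ?case
    by (simp only: sum_binomial_Suc)
qed simp

section \<open>Polynomial sequences\<close>

lemma polynomial_seq_const: "polynomial_seq (\<lambda>_. c)"
  unfolding polynomial_seq_def by (rule exI[of _ "[:c:]"]) simp

lemma polynomial_seq_add:
  assumes "polynomial_seq f" and "polynomial_seq g"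
  shows "polynomial_seq (\<lambda>n. f n + g n)"
  using assms unfolding polynomial_seq_def by (metis poly_add)

lemma polynomial_seq_minus:
  assumes "polynomial_seq f" and "polynomial_seq g"
  shows "polynomial_seq (\<lambda>n. f n - g n)"
  using assms unfolding polynomial_seq_def by (metis poly_diff)

lemma polynomial_seq_cmult:
  assumes "polynomial_seq f"
  shows "polynomial_seq (\<lambda>n. c * f n)"
  using assms unfolding polynomial_seq_def by (metis poly_smult)

lemma polynomial_seq_sum:
  assumes "\<And>i. i \<in> A \<Longrightarrow> polynomial_seq (f i)"
  shows "polynomial_seq (\<lambda>n. \<Sum>i\<in>A. f i n)"
  using assms
  by (induction A rule: infinite_finite_induct)
    (auto intro: polynomial_seq_add polynomial_seq_const[of 0])

lemma polynomial_seq_binomial: "polynomial_seq (\<lambda>n. of_nat (n choose k))"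
proof -
  have "of_nat (n choose k) = poly (smult (1 / fact k) (\<Prod>i<k. [:- of_nat i, 1:])) (of_nat n :: complex)" for n
    by (simp add: binomial_gbinomial gbinomial_prod_rev poly_prod atLeast0LessThan)
  then show ?thesis
    unfolding polynomial_seq_def by blast
qed

lemma polynomial_seq_cnj:
  assumes "polynomial_seq f"
  shows "polynomial_seq (\<lambda>n. cnj (f n))"
proof -
  from assms obtain p where p: "\<And>n. f n = poly p (of_nat n)"
    unfolding polynomial_seq_def by blast
  have "cnj (f n) = poly (map_poly cnj p) (of_nat n)" for n
    using poly_cnj[of p "of_nat n"] by (simp add: p)
  then show ?thesis
    unfolding polynomial_seq_def by blast
qed

text \<open>In Newton's formula only the terms with \<open>k < m\<close> survive, and each binomial
  coefficient is a polynomial in its upper argument.\<close>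

lemma polynomial_seq_if_fdiff_funpow_eq_0:
  assumes "(fdiff ^^ m) f = (\<lambda>_. 0)"
  shows "polynomial_seq f"
proof -
  have zero: "(fdiff ^^ k) f 0 = 0" if "m \<le> k" for k
    using fdiff_funpow_eq_0_mono[OF assms that] by simp
  have "f n = (\<Sum>k<m. of_nat (n choose k) * (fdiff ^^ k) f 0)" for n
  proof -
    have "f n = (\<Sum>k\<le>n. of_nat (n choose k) * (fdiff ^^ k) f 0)"
      by (rule newton_forward)
    \<comment> \<open>The union is a common range that avoids comparing \<open>n\<close> with
      \<open>m\<close>: terms with \<open>k > n\<close> vanish by the binomial coefficient, those
      with \<open>k \<ge> m\<close> by \<open>zero\<close>.\<close>
    also have "\<dots> = (\<Sum>k\<in>{..n} \<union> {..<m}. of_nat (n choose k) * (fdiff ^^ k) f 0)"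
      by (rule sum.mono_neutral_left) auto
    also have "\<dots> = (\<Sum>k<m. of_nat (n choose k) * (fdiff ^^ k) f 0)"
      by (rule sum.mono_neutral_right) (auto simp: zero)
    finally show ?thesis .
  qed
  then have "f = (\<lambda>n. \<Sum>k<m. (fdiff ^^ k) f 0 * of_nat (n choose k))"
    by (auto simp: mult.commute)
  moreover have "polynomial_seq (\<lambda>n. \<Sum>k<m. (fdiff ^^ k) f 0 * of_nat (n choose k))"
    by (intro polynomial_seq_sum polynomial_seq_cmult polynomial_seq_binomial)
  ultimately show ?thesis
    by simp
qed

section \<open>Linear independence of exponential polynomials\<close>

lemma poly_eq_0_if_eventually_zero:
  fixes p :: "'a::{idom, ring_char_0} poly"
  assumes "\<And>n. n \<ge> m \<Longrightarrow> poly p (of_nat n) = 0"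
  shows "p = 0"
proof (rule ccontr)
  assume "p \<noteq> 0"
  then have "finite {x. poly p x = 0}"
    by (rule poly_roots_finite)
  moreover have "of_nat ` {m..} \<subseteq> {x. poly p x = 0}"
    using assms by auto
  ultimately have "finite (of_nat ` {m..} :: 'a set)"
    by (rule rev_finite_subset)
  then show False
    by (simp add: finite_image_iff inj_on_def infinite_Ici)
qed

text \<open>The shift keeps degree and leading coefficient, so the top coefficients cancel. The
  first alternative covers constants, below whose degree there is nothing.\<close>

lemma degree_pcompose_shift_diff:
  fixes p :: "'a::idom poly"
  shows "p \<circ>\<^sub>p [:1, 1:] - p = 0 \<or> degree (p \<circ>\<^sub>p [:1, 1:] - p) < degree p"
proof (cases "p \<circ>\<^sub>p [:1, 1:] - p = 0")
  case False
  have deg: "degree (p \<circ>\<^sub>p [:1, 1:]) = degree p"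
    by (simp add: degree_pcompose)
  have "lead_coeff (p \<circ>\<^sub>p [:1, 1:]) = lead_coeff p"
    by (simp add: lead_coeff_comp)
  with deg have "coeff (p \<circ>\<^sub>p [:1, 1:] - p) (degree p) = 0"
    by simp
  moreover have "degree (p \<circ>\<^sub>p [:1, 1:] - p) \<le> degree p"
    by (rule degree_diff_le) (simp_all add: deg)
  ultimately show ?thesis
    using False by (metis le_neq_implies_less leading_coeff_0_iff)
qed simp

text \<open>Since the shift keeps the leading coefficient, comparing coefficients in degree
  \<open>degree p\<close> amounts to \<open>(w - v) * lead_coeff p = 0\<close>.\<close>

lemma pcompose_shift_smult_eq_0:
  fixes p :: "'a::idom poly"
  assumes "smult w (p \<circ>\<^sub>p [:1, 1:]) - smult v p = 0" and "w \<noteq> v"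
  shows "p = 0"
proof -
  have "degree (p \<circ>\<^sub>p [:1, 1:]) = degree p" and "lead_coeff (p \<circ>\<^sub>p [:1, 1:]) = lead_coeff p"
    using lead_coeff_comp[of "[:1, 1:]" p] by (simp_all add: degree_pcompose)
  then have lc: "coeff (p \<circ>\<^sub>p [:1, 1:]) (degree p) = lead_coeff p"
    by metis
  have "w * coeff (p \<circ>\<^sub>p [:1, 1:]) (degree p) = v * lead_coeff p"
    using assms(1) by (metis coeff_smult right_minus_eq)
  with assms(2) show ?thesis
    by (simp add: lc)
qed

text \<open>Applying \<open>f \<mapsto> f (n + 1) - v f n\<close> lowers the degree of the coefficient of \<open>v ^ n\<close> and
  preserves the degrees of the other coefficients.\<close>

lemma exponential_polynomials_independent:
  fixes p :: "'a::{idom, ring_char_0} \<Rightarrow> 'a poly"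
  assumes "finite S" and "0 \<notin> S"
    and "\<And>n. (\<Sum>w\<in>S. w ^ n * poly (p w) (of_nat n)) = 0"
    and "w \<in> S"
  shows "p w = 0"
  using assms
proof (induction S arbitrary: p w rule: finite_induct)
  case (insert v S)
  \<comment> \<open>Inner induction on a strict bound \<open>d\<close> for the degree at
    \<open>v\<close>. The zero polynomial lies below every bound, so \<open>d = 0\<close> means
    \<open>p v = 0\<close> and the term for \<open>v\<close> drops out.\<close>
  have "\<forall>u\<in>insert v S. p u = 0"
    if "\<And>n. (\<Sum>w\<in>insert v S. w ^ n * poly (p w) (of_nat n)) = 0"
      and "p v = 0 \<or> degree (p v) < d" for d p
    using that
  proof (induction d arbitrary: p)
    case 0
    then have "p v = 0"
      by simp
    moreover from this have "(\<Sum>w\<in>S. w ^ n * poly (p w) (of_nat n)) = 0" for n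
      using 0(1)[of n] insert.hyps by simp
    ultimately show ?case
      using insert.IH[of p] insert.prems(1) by simp
  next
    case (Suc d)
    \<comment> \<open>\<open>q w\<close> is the coefficient of \<open>w ^ n\<close> after applying
      the operator; its relation combines those for \<open>p\<close> at \<open>Suc n\<close> and at
      \<open>n\<close>.\<close>
    define q where "q = (\<lambda>w. smult w (p w \<circ>\<^sub>p [:1, 1:]) - smult v (p w))"
    have "(\<Sum>w\<in>insert v S. w ^ n * poly (q w) (of_nat n))
        = (\<Sum>w\<in>insert v S. w ^ Suc n * poly (p w) (of_nat (Suc n)))
          - v * (\<Sum>w\<in>insert v S. w ^ n * poly (p w) (of_nat n))" for n
      by (simp only: q_def sum_distrib_left sum_subtractf[symmetric])
        (rule sum.cong, auto simp: poly_pcompose algebra_simps)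
    then have "(\<Sum>w\<in>insert v S. w ^ n * poly (q w) (of_nat n)) = 0" for n
      by (simp only: Suc.prems(1)) simp
    moreover have "q v = smult v (p v \<circ>\<^sub>p [:1, 1:] - p v)"
      by (simp add: q_def smult_diff_right)
    then have "q v = 0 \<or> degree (q v) < d"
      using degree_pcompose_shift_diff[of "p v"] Suc.prems(2) insert.prems(1)
      by (auto simp: degree_smult_eq)
    ultimately have "\<forall>u\<in>insert v S. q u = 0"
      by (rule Suc.IH)
    \<comment> \<open>For \<open>u \<noteq> v\<close> the passage from \<open>p u\<close> to
      \<open>q u\<close> is injective, so only the term at \<open>v\<close> is left in the relation
      for \<open>p\<close>.\<close>
    then have S: "\<forall>u\<in>S. p u = 0"
      using insert.hyps(2) pcompose_shift_smult_eq_0 by (fastforce simp: q_def)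
    then have "v ^ n * poly (p v) (of_nat n) = 0" for n
      using Suc.prems(1)[of n] insert.hyps by simp
    then have "p v = 0"
      using insert.prems(1) by (intro poly_eq_0_if_eventually_zero[of 0]) auto
    with S show ?case
      by simp
  qed
  from this[of p "Suc (degree (p v))"] insert.prems show ?case
    by auto
qed simp

text \<open>The last hypothesis is a relation between powers of \<open>1\<close>, \<open>w\<close>
  and \<open>cnj w\<close>. These are distinct unless \<open>w = -1\<close>, where the last two
  merge and only \<open>q n + cnj (q n)\<close> is seen to vanish.\<close>

lemma unimodular_oscillation:
  fixes w :: complex
  assumes "norm w = 1" and "w \<noteq> 1" and "polynomial_seq q"
    and "polynomial_seq (\<lambda>n. w ^ n * q n + cnj (w ^ n * q n))"
  shows "Re (w ^ n * q n) = 0" and "w \<noteq> -1 \<Longrightarrow> q n = 0"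
proof -
  from assms(3) obtain p where p: "\<And>n. q n = poly p (of_nat n)"
    unfolding polynomial_seq_def by blast
  from polynomial_seq_cnj[OF assms(3)] obtain p' where p': "\<And>n. cnj (q n) = poly p' (of_nat n)"
    unfolding polynomial_seq_def by blast
  from assms(4) obtain r where
    r: "\<And>n. w ^ n * q n + cnj (w ^ n * q n) = poly r (of_nat n)"
    unfolding polynomial_seq_def by blast
  have "w \<noteq> 0"
    using assms(1) by auto
  have *: "q n = 0" if "w \<noteq> -1"
  proof -
    have "cnj w \<noteq> w"
    proof
      assume "cnj w = w"
      then have "w * w = 1"
        using assms(1) complex_norm_square[of w] by simp
      with assms(2) that show False
        by (simp add: square_eq_1_iff)
    qed
    moreover have "cnj w \<noteq> 1"
      using assms(2) by (metis complex_cnj_cnj complex_cnj_one)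
    \<comment> \<open>The polynomial \<open>r\<close> moves to the left as the coefficient of base
      1; within the sum, the last branch is met only at \<open>cnj w\<close>.\<close>
    moreover define c where "c = (\<lambda>v. if v = 1 then - r else if v = w then p else p')"
    ultimately have "(\<Sum>v\<in>{1, w, cnj w}. v ^ k * poly (c v) (of_nat k)) = 0" for k
      using assms(2) r[of k] by (simp add: p[symmetric] p'[symmetric])
    then have "c w = 0"
      using \<open>w \<noteq> 0\<close> by (intro exponential_polynomials_independent[of "{1, w, cnj w}"]) auto
    with assms(2) show ?thesis
      by (simp add: c_def p)
  qed
  then show "w \<noteq> -1 \<Longrightarrow> q n = 0" .
  show "Re (w ^ n * q n) = 0"
  proof (cases "w = -1")
    case True
    define c where "c = (\<lambda>v::complex. if v = 1 then - r else p + p')"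
    have "(\<Sum>v\<in>{1, -1}. v ^ k * poly (c v) (of_nat k)) = 0" for k
      using r[of k] by (simp add: c_def p[symmetric] p'[symmetric] True algebra_simps)
    then have "c (-1) = 0"
      by (intro exponential_polynomials_independent[of "{1, -1}"]) auto
    then have "p + p' = 0"
      by (simp add: c_def)
    then have "q n + cnj (q n) = 0"
      by (metis p p' poly_0 poly_add)
    then have "Re (q n) = 0"
      by (simp add: complex_eq_iff)
    with True show ?thesis
      by (cases "even n") auto
  next
    case False
    then show ?thesis
      by (simp add: *)
  qed
qed

section \<open>Complex inner products and cyclic spaces\<close>

lemma cinner_add_right: "cinner x (y + w) = cinner x y + cinner x w"
  by (metis cinner_commute cinner_add_left complex_cnj_add)

lemma cinner_scaleC_right: "cinner x (a *\<^sub>C y) = cnj a * cinner x y"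
  by (metis cinner_commute cinner_scaleC_left complex_cnj_mult)

lemma cinner_zero_left: "cinner 0 y = 0"
  using cinner_add_left[of 0 0 y] by simp

lemma cinner_zero_right: "cinner x 0 = 0"
  using cinner_add_right[of x 0 0] by simp

text \<open>The cross term is kept as a sum of conjugates rather than twice a real part, so that it
  can be read as a complex exponential polynomial.\<close>

lemma norm_add_sq_cinner:
  "complex_of_real ((norm (x + y))\<^sup>2)
    = of_real ((norm x)\<^sup>2) + of_real ((norm y)\<^sup>2) + (cinner x y + cnj (cinner x y))"
  by (simp only: cinner_self[symmetric] cinner_add_left cinner_add_right cinner_commute[of y x])
    (simp add: add_ac)

lemma corthogonal_cspan:
  assumes "\<And>x y. x \<in> A \<Longrightarrow> y \<in> B \<Longrightarrow> cinner x y = 0"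
  shows "corthogonal (cspan A) (cspan B)"
proof -
  have *: "cinner x y = 0" if "x \<in> A" "y \<in> cspan B" for x y
    using that(2)
  proof (induction rule: complex_vector.span_induct_alt)
    case base
    show ?case by (rule cinner_zero_right)
  next
    case (step c u v)
    with that(1) show ?case
      by (simp add: cinner_add_right cinner_scaleC_right assms)
  qed
  have "cinner x y = 0" if "x \<in> cspan A" "y \<in> cspan B" for x y
    using that(1)
  proof (induction rule: complex_vector.span_induct_alt)
    case base
    show ?case by (rule cinner_zero_left)
  next
    case (step c u v)
    with that(2) show ?case
      by (simp add: cinner_add_left cinner_scaleC_left *)
  qed
  then show ?thesis
    by (auto simp: corthogonal_def)
qed

lemma cyclic_space_scaleC_orbit: "c *\<^sub>C (T ^^ j) h \<in> cyclic_space T h"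
  unfolding cyclic_space_def
  by (intro complex_vector.span_scale complex_vector.span_base) blast

lemma cyclic_space_orbit: "(T ^^ j) h \<in> cyclic_space T h"
  using cyclic_space_scaleC_orbit[of 1] by (simp add: scaleC_one)

lemma cyclic_space_self: "h \<in> cyclic_space T h"
  using cyclic_space_orbit[of 0] by simp

lemma cyclic_space_funpow:
  assumes "clinear T" and "x \<in> cyclic_space T h"
  shows "(T ^^ n) x \<in> cyclic_space T h"
  by (induction n) (auto simp: assms cyclic_space_invariant)

section \<open>Orbits of vectors in Jordan blocks\<close>

context
  fixes T :: "'a::complex_inner \<Rightarrow> 'a"
  assumes T: "clinear T"
begin

interpretation T: Vector_Spaces.linear scaleC scaleC T
  by (rule T)

lemma funpow_add_vector: "(T ^^ n) (x + y) = (T ^^ n) x + (T ^^ n) y"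
  by (induction n) (auto simp: T.add)

lemma funpow_scaleC: "(T ^^ n) (c *\<^sub>C x) = c *\<^sub>C (T ^^ n) x"
  by (induction n) (auto simp: T.scale)

text \<open>Separates the eigenvalue part of \<open>T x\<close> from
  \<open>T x - z *\<^sub>C x\<close>, whose nilpotency exponent is one less; the inductions on these
  exponents rest on this.\<close>

lemma funpow_jordan_step: "(T ^^ Suc n) x = z *\<^sub>C (T ^^ n) x + (T ^^ n) (T x - z *\<^sub>C x)"
  by (simp add: funpow_swap1 funpow_scaleC[symmetric] funpow_add_vector[symmetric])

lemma funpow_zero: "(T ^^ n) 0 = 0"
  by (induction n) (auto simp: T.zero)

text \<open>After division by \<open>z ^ n\<close>, one difference replaces \<open>x\<close> by
  \<open>T x - z *\<^sub>C x\<close> up to the factor \<open>1 / z\<close>, and \<open>a\<close>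
  replacements reach 0. Keeping \<open>y\<close> fixed allows different powers of \<open>T\<close>
  on the two sides in the orthogonality argument.\<close>

lemma fdiff_funpow_orbit_eq_0:
  assumes "z \<noteq> 0" and "((\<lambda>x. T x - z *\<^sub>C x) ^^ a) x = 0"
  shows "(fdiff ^^ a) (\<lambda>n. cinner ((T ^^ n) x) y / z ^ n) = (\<lambda>_. 0)"
  using assms(2)
proof (induction a arbitrary: x)
  case 0
  then show ?case
    by (simp add: funpow_zero cinner_zero_left)
next
  case (Suc a)
  define N where "N = (\<lambda>x. T x - z *\<^sub>C x)"
  have "fdiff (\<lambda>n. cinner ((T ^^ n) x) y / z ^ n)
      = (\<lambda>n. (1 / z) * (cinner ((T ^^ n) (N x)) y / z ^ n))"
    using assms(1)
    by (simp add: fdiff_def N_def funpow_jordan_step[of _ _ z] cinner_add_left cinner_scaleC_left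
        field_simps del: funpow.simps(2))
  moreover have "(N ^^ Suc a) x = 0"
    using Suc.prems by (simp only: N_def)
  then have "(N ^^ a) (N x) = 0"
    by (simp add: funpow_swap1)
  then have "(fdiff ^^ a) (\<lambda>n. cinner ((T ^^ n) (N x)) y / z ^ n) = (\<lambda>_. 0)"
    using Suc.IH[folded N_def] by blast
  ultimately show ?case
    by (simp only: funpow_Suc_right comp_apply fdiff_funpow_cmult mult_zero_right)
qed

text \<open>One difference gives a combination of three sequences of the same kind, in which
  \<open>x\<close>, \<open>y\<close> or both are replaced by their nilpotent images; hence induction
  on \<open>a + b\<close>. The conjugate of \<open>z\<^sub>2\<close> comes from conjugate linearity
  in the second argument.\<close>

lemma fdiff_funpow_cross_eq_0:
  assumes "z\<^sub>1 \<noteq> 0" and "z\<^sub>2 \<noteq> 0"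
    and "((\<lambda>x. T x - z\<^sub>1 *\<^sub>C x) ^^ a) x = 0" and "((\<lambda>x. T x - z\<^sub>2 *\<^sub>C x) ^^ b) y = 0"
  shows "(fdiff ^^ (a + b)) (\<lambda>n. cinner ((T ^^ n) x) ((T ^^ n) y) / (z\<^sub>1 * cnj z\<^sub>2) ^ n) = (\<lambda>_. 0)"
  using assms(3,4)
proof (induction "a + b" arbitrary: a b x y rule: less_induct)
  case less
  define F where "F = (\<lambda>x y n. cinner ((T ^^ n) x) ((T ^^ n) y) / (z\<^sub>1 * cnj z\<^sub>2) ^ n)"
  define N\<^sub>1 N\<^sub>2 where "N\<^sub>1 = (\<lambda>x. T x - z\<^sub>1 *\<^sub>C x)" and "N\<^sub>2 = (\<lambda>x. T x - z\<^sub>2 *\<^sub>C x)"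
  have IH: "(fdiff ^^ (a' + b')) (F x' y') = (\<lambda>_. 0)"
    if "a' + b' < a + b" "(N\<^sub>1 ^^ a') x' = 0" "(N\<^sub>2 ^^ b') y' = 0" for a' b' x' y'
    using less.hyps[of a' b' x' y'] that by (simp add: F_def N\<^sub>1_def N\<^sub>2_def)
  have "(fdiff ^^ (a + b)) (F x y) = (\<lambda>_. 0)"
  proof (cases "x = 0 \<or> y = 0")
    \<comment> \<open>This case absorbs \<open>a = 0\<close> and \<open>b = 0\<close>, so that both
      exponents are successors in the other one.\<close>
    case True
    then have "F x y = (\<lambda>_. 0)"
      by (auto simp: F_def funpow_zero cinner_zero_left cinner_zero_right)
    then show ?thesis
      by (simp add: fdiff_funpow_zero)
  next
    case False
    obtain a' b' where ab: "a = Suc a'" "b = Suc b'"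
      using False less.prems by (cases a; cases b) auto
    have "(N\<^sub>1 ^^ Suc a') x = 0" and "(N\<^sub>2 ^^ Suc b') y = 0"
      using less.prems by (simp_all only: ab N\<^sub>1_def N\<^sub>2_def)
    then have x: "(N\<^sub>1 ^^ a') (N\<^sub>1 x) = 0" "(N\<^sub>1 ^^ Suc a') x = 0"
      and y: "(N\<^sub>2 ^^ b') (N\<^sub>2 y) = 0" "(N\<^sub>2 ^^ Suc b') y = 0"
      by (simp_all add: funpow_swap1)
    have "fdiff (F x y) n = (1 / cnj z\<^sub>2) * F x (N\<^sub>2 y) n + ((1 / z\<^sub>1) * F (N\<^sub>1 x) y n
        + (1 / (z\<^sub>1 * cnj z\<^sub>2)) * F (N\<^sub>1 x) (N\<^sub>2 y) n)" for n
    proof -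
      define W where "W = (z\<^sub>1 * cnj z\<^sub>2) ^ n"
      have "W \<noteq> 0"
        using assms(1,2) by (simp add: W_def)
      have "cinner ((T ^^ Suc n) x) ((T ^^ Suc n) y)
          = z\<^sub>1 * cnj z\<^sub>2 * cinner ((T ^^ n) x) ((T ^^ n) y) + z\<^sub>1 * cinner ((T ^^ n) x) ((T ^^ n) (N\<^sub>2 y))
            + cnj z\<^sub>2 * cinner ((T ^^ n) (N\<^sub>1 x)) ((T ^^ n) y) + cinner ((T ^^ n) (N\<^sub>1 x)) ((T ^^ n) (N\<^sub>2 y))"
        unfolding N\<^sub>1_def N\<^sub>2_def funpow_jordan_step[of n x z\<^sub>1] funpow_jordan_step[of n y z\<^sub>2]
          cinner_add_left cinner_scaleC_left cinner_add_right cinner_scaleC_right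
        by (simp add: algebra_simps)
      with \<open>W \<noteq> 0\<close> assms(1,2) show ?thesis
        unfolding fdiff_def F_def power_Suc W_def[symmetric] by (simp add: field_simps del: funpow.simps(2))
    qed
    then have "fdiff (F x y) = (\<lambda>n. (1 / cnj z\<^sub>2) * F x (N\<^sub>2 y) n + ((1 / z\<^sub>1) * F (N\<^sub>1 x) y n
        + (1 / (z\<^sub>1 * cnj z\<^sub>2)) * F (N\<^sub>1 x) (N\<^sub>2 y) n))"
      by blast
    moreover have "(fdiff ^^ Suc (a' + b')) (F x (N\<^sub>2 y)) = (\<lambda>_. 0)"
      using IH[of "Suc a'" b' x "N\<^sub>2 y"] x y by (simp add: ab)
    moreover have "(fdiff ^^ Suc (a' + b')) (F (N\<^sub>1 x) y) = (\<lambda>_. 0)"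
      using IH[of a' "Suc b'" "N\<^sub>1 x" y] x y by (simp add: ab)
    \<comment> \<open>With both exponents lowered, one difference fewer suffices; the order is then
      raised to match the other two terms.\<close>
    moreover have "(fdiff ^^ (a' + b')) (F (N\<^sub>1 x) (N\<^sub>2 y)) = (\<lambda>_. 0)"
      using IH[of a' b' "N\<^sub>1 x" "N\<^sub>2 y"] x y by (simp add: ab)
    then have "(fdiff ^^ Suc (a' + b')) (F (N\<^sub>1 x) (N\<^sub>2 y)) = (\<lambda>_. 0)"
      by (rule fdiff_funpow_eq_0_mono) simp
    ultimately have "(fdiff ^^ Suc (a' + b')) (fdiff (F x y)) = (\<lambda>_. 0)"
      by (simp only: fdiff_funpow_add fdiff_funpow_cmult) simp
    then show ?thesis
      by (simp add: ab funpow_swap1)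
  qed
  then show ?case
    by (simp add: F_def)
qed

text \<open>The cross term of \<open>x\<close> with itself, where \<open>z * cnj z = 1\<close>
  removes the denominator.\<close>

lemma fdiff_funpow_norm_eq_0:
  assumes "norm z = 1" and "((\<lambda>x. T x - z *\<^sub>C x) ^^ a) x = 0"
  shows "(fdiff ^^ (a + a)) (\<lambda>n. complex_of_real ((norm ((T ^^ n) x))\<^sup>2)) = (\<lambda>_. 0)"
proof -
  have "z * cnj z = 1" and "z \<noteq> 0"
    using assms(1) complex_norm_square[of z] by auto
  with fdiff_funpow_cross_eq_0[of z z a x a x] assms(2) show ?thesis
    by (simp add: cinner_self)
qed

text \<open>The defining sum is, up to sign, the \<open>m\<close>-th difference at 0. The difference
  at \<open>n\<close> for \<open>x\<close> is the difference at 0 for \<open>(T ^^ n) x\<close>,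
  which lies in \<open>N\<close> by invariance.\<close>

lemma m_isometry_on_iff_fdiff:
  assumes "\<And>x. x \<in> N \<Longrightarrow> T x \<in> N"
  shows "m_isometry_on m N T \<longleftrightarrow>
    (\<forall>x\<in>N. (fdiff ^^ m) (\<lambda>n. complex_of_real ((norm ((T ^^ n) x))\<^sup>2)) = (\<lambda>_. 0))"
proof -
  define F where "F = (\<lambda>x n. complex_of_real ((norm ((T ^^ n) x))\<^sup>2))"
  have inv: "(T ^^ n) x \<in> N" if "x \<in> N" for n x
    by (induction n) (auto simp: that assms)
  have shift: "(fdiff ^^ m) (F x) n = (fdiff ^^ m) (F ((T ^^ n) x)) 0" for x n
  proof -
    have "F ((T ^^ n) x) = (\<lambda>k. F x (n + k))"
      by (auto simp: F_def add.commute[of n] funpow_add)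
    then show ?thesis
      by (simp add: fdiff_funpow_shift)
  qed
  have "complex_of_real (\<Sum>k\<le>m. (-1) ^ k * real (m choose k) * (norm ((T ^^ k) x))\<^sup>2)
      = (\<Sum>k\<le>m. of_nat (m choose k) * ((-1) ^ k * F x (0 + k)))" for x
    by (simp add: F_def mult_ac)
  then have "(fdiff ^^ m) (F x) 0
      = (-1) ^ m * complex_of_real (\<Sum>k\<le>m. (-1) ^ k * real (m choose k) * (norm ((T ^^ k) x))\<^sup>2)" for x
    by (simp only: fdiff_funpow_sum)
  then have "(\<Sum>k\<le>m. (-1) ^ k * real (m choose k) * (norm ((T ^^ k) x))\<^sup>2) = 0
      \<longleftrightarrow> (fdiff ^^ m) (F x) 0 = 0" for x
    by (simp only: mult_eq_0_iff of_real_eq_0_iff) simp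
  then have "m_isometry_on m N T \<longleftrightarrow> (\<forall>x\<in>N. (fdiff ^^ m) (F x) 0 = 0)"
    by (simp add: m_isometry_on_def)
  also have "\<dots> \<longleftrightarrow> (\<forall>x\<in>N. (fdiff ^^ m) (F x) = (\<lambda>_. 0))"
    unfolding fun_eq_iff using shift inv by metis
  finally show ?thesis
    by (simp add: F_def)
qed

end

section \<open>Orthogonality of two blocks and its equivalent conditions\<close>

theorem theorem6p1:
  fixes T :: "'a::complex_inner \<Rightarrow> 'a" and h\<^sub>1 h\<^sub>2 :: 'a and z\<^sub>1 z\<^sub>2 :: complex
  assumes "clinear T"
    and "admits_jordan_block T h\<^sub>1 z\<^sub>1" and "admits_jordan_block T h\<^sub>2 z\<^sub>2"
    and "norm z\<^sub>1 = 1" and "norm z\<^sub>2 = 1" and "z\<^sub>1 \<noteq> z\<^sub>2"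
  shows "(corthogonal (cyclic_space T h\<^sub>1) (cyclic_space T h\<^sub>2) \<longleftrightarrow>
      (z\<^sub>1 = - z\<^sub>2 \<and>
        (\<exists>\<epsilon>\<^sub>1\<in>{-1, 1}. \<exists>\<epsilon>\<^sub>2\<in>{-\<i>, \<i>}. \<forall>\<epsilon>\<in>{\<epsilon>\<^sub>1, \<epsilon>\<^sub>2}. \<forall>j.
          polynomial_seq (\<lambda>n. of_real ((norm ((T ^^ n) (\<epsilon> *\<^sub>C (T ^^ j) h\<^sub>1 + h\<^sub>2)))\<^sup>2)))) \<or>
      (z\<^sub>1 \<noteq> - z\<^sub>2 \<and>
        (\<forall>j. polynomial_seq (\<lambda>n. of_real ((norm ((T ^^ n) ((T ^^ j) h\<^sub>1 + h\<^sub>2)))\<^sup>2)))))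
    \<and> (corthogonal (cyclic_space T h\<^sub>1) (cyclic_space T h\<^sub>2) \<longleftrightarrow>
      (\<forall>g\<^sub>1\<in>cyclic_space T h\<^sub>1.
        polynomial_seq (\<lambda>n. of_real ((norm ((T ^^ n) (g\<^sub>1 + h\<^sub>2)))\<^sup>2))))
    \<and> (corthogonal (cyclic_space T h\<^sub>1) (cyclic_space T h\<^sub>2) \<longleftrightarrow>
      (\<forall>g\<^sub>1\<in>cyclic_space T h\<^sub>1. \<forall>g\<^sub>2\<in>cyclic_space T h\<^sub>2.
        polynomial_seq (\<lambda>n. of_real ((norm ((T ^^ n) (g\<^sub>1 + g\<^sub>2)))\<^sup>2))))
    \<and> (corthogonal (cyclic_space T h\<^sub>1) (cyclic_space T h\<^sub>2) \<longleftrightarrow>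
      (\<exists>m\<ge>1. m_isometry_on m (cyclic_space T h\<^sub>1 + cyclic_space T h\<^sub>2) T))"
proof -
  define C\<^sub>1 C\<^sub>2 where "C\<^sub>1 = cyclic_space T h\<^sub>1" and "C\<^sub>2 = cyclic_space T h\<^sub>2"
  define P where "P = (\<lambda>x. polynomial_seq (\<lambda>n. of_real ((norm ((T ^^ n) x))\<^sup>2)))"
  define w where "w = z\<^sub>1 * cnj z\<^sub>2"
  have nz: "z\<^sub>1 \<noteq> 0" "z\<^sub>2 \<noteq> 0"
    using assms(4,5) by auto
  have "z\<^sub>2 * cnj z\<^sub>2 = 1"
    using assms(5) complex_norm_square[of z\<^sub>2] by simp
  \<comment> \<open>Since \<open>cnj z\<^sub>2\<close> is the inverse of \<open>z\<^sub>2\<close>,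
    \<open>w\<close> is the quotient of the eigenvalues; so it avoids 1, and is -1 exactly for
    opposite eigenvalues.\<close>
  then have w_z: "w * z\<^sub>2 = z\<^sub>1"
    by (simp add: w_def mult.commute mult.left_commute)
  have w: "norm w = 1" "w \<noteq> 1" "w = -1 \<longleftrightarrow> z\<^sub>1 = - z\<^sub>2"
  proof -
    show "norm w = 1"
      using assms(4,5) by (simp add: w_def norm_mult)
    show "w \<noteq> 1"
      using w_z assms(6) by auto
    show "w = -1 \<longleftrightarrow> z\<^sub>1 = - z\<^sub>2"
      using w_z nz(2) by (metis mult_cancel_right mult_minus1)
  qed
  obtain a where a: "\<And>x. x \<in> C\<^sub>1 \<Longrightarrow> ((\<lambda>x. T x - z\<^sub>1 *\<^sub>C x) ^^ a) x = 0"
    using assms(2) unfolding admits_jordan_block_def nilpotent_on_def C\<^sub>1_def by blast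
  obtain b where b: "\<And>x. x \<in> C\<^sub>2 \<Longrightarrow> ((\<lambda>x. T x - z\<^sub>2 *\<^sub>C x) ^^ b) x = 0"
    using assms(3) unfolding admits_jordan_block_def nilpotent_on_def C\<^sub>2_def by blast
  note norm1 = fdiff_funpow_norm_eq_0[OF assms(1,4) a]
  note norm2 = fdiff_funpow_norm_eq_0[OF assms(1,5) b]
  have expand: "complex_of_real ((norm ((T ^^ n) (x + y)))\<^sup>2)
      = of_real ((norm ((T ^^ n) x))\<^sup>2) + of_real ((norm ((T ^^ n) y))\<^sup>2)
        + (cinner ((T ^^ n) x) ((T ^^ n) y) + cnj (cinner ((T ^^ n) x) ((T ^^ n) y)))" for n x y
    by (simp only: funpow_add_vector[OF assms(1)] norm_add_sq_cinner)

  \<comment> \<open>(i) to (v): orbits stay in the invariant spaces, so orthogonality removes the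
    cross term at every power.\<close>
  have orth_isometry: "\<exists>m\<ge>1. m_isometry_on m (C\<^sub>1 + C\<^sub>2) T" if "corthogonal C\<^sub>1 C\<^sub>2"
  proof -
    \<comment> \<open>This dominates both orders \<open>a + a\<close> and \<open>b + b\<close>, and
      \<open>Suc\<close> provides \<open>m \<ge> 1\<close>.\<close>
    define m where "m = Suc ((a + a) + (b + b))"
    have "(fdiff ^^ m) (\<lambda>n. complex_of_real ((norm ((T ^^ n) x))\<^sup>2)) = (\<lambda>_. 0)"
      if "x \<in> C\<^sub>1 + C\<^sub>2" for x
    proof -
      from that obtain x\<^sub>1 x\<^sub>2 where x: "x = x\<^sub>1 + x\<^sub>2" "x\<^sub>1 \<in> C\<^sub>1" "x\<^sub>2 \<in> C\<^sub>2"
        by (rule set_plus_elim)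
      have "cinner ((T ^^ n) x\<^sub>1) ((T ^^ n) x\<^sub>2) = 0" for n
        using \<open>corthogonal C\<^sub>1 C\<^sub>2\<close> x(2,3) cyclic_space_funpow[OF assms(1)]
        by (simp add: corthogonal_def C\<^sub>1_def C\<^sub>2_def)
      then have "(\<lambda>n. complex_of_real ((norm ((T ^^ n) x))\<^sup>2))
          = (\<lambda>n. of_real ((norm ((T ^^ n) x\<^sub>1))\<^sup>2) + of_real ((norm ((T ^^ n) x\<^sub>2))\<^sup>2))"
        by (simp only: x(1) expand) simp
      moreover have "(fdiff ^^ m) (\<lambda>n. complex_of_real ((norm ((T ^^ n) x\<^sub>1))\<^sup>2)) = (\<lambda>_. 0)"
        by (rule fdiff_funpow_eq_0_mono[OF norm1[OF x(2)]]) (simp add: m_def)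
      moreover have "(fdiff ^^ m) (\<lambda>n. complex_of_real ((norm ((T ^^ n) x\<^sub>2))\<^sup>2)) = (\<lambda>_. 0)"
        by (rule fdiff_funpow_eq_0_mono[OF norm2[OF x(3)]]) (simp add: m_def)
      ultimately show ?thesis
        by (simp only: fdiff_funpow_add) simp
    qed
    then have "m_isometry_on m (C\<^sub>1 + C\<^sub>2) T"
      using cyclic_space_plus_invariant[OF assms(1)] unfolding C\<^sub>1_def C\<^sub>2_def
      by (subst m_isometry_on_iff_fdiff[OF assms(1)]) auto
    then show ?thesis
      by (intro exI[of _ m]) (simp add: m_def)
  qed

  \<comment> \<open>(v) to (iv): vanishing \<open>m\<close>-th differences make the squared norms
    polynomial.\<close>
  have isometry_all: "\<forall>g\<^sub>1\<in>C\<^sub>1. \<forall>g\<^sub>2\<in>C\<^sub>2. P (g\<^sub>1 + g\<^sub>2)" if "\<exists>m\<ge>1. m_isometry_on m (C\<^sub>1 + C\<^sub>2) T"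
  proof (intro ballI)
    fix g\<^sub>1 g\<^sub>2
    assume "g\<^sub>1 \<in> C\<^sub>1" "g\<^sub>2 \<in> C\<^sub>2"
    then have "g\<^sub>1 + g\<^sub>2 \<in> C\<^sub>1 + C\<^sub>2"
      by (rule set_plus_intro)
    moreover from that obtain m where "m_isometry_on m (C\<^sub>1 + C\<^sub>2) T"
      by blast
    ultimately show "P (g\<^sub>1 + g\<^sub>2)"
      using m_isometry_on_iff_fdiff[OF assms(1), of "C\<^sub>1 + C\<^sub>2" m] cyclic_space_plus_invariant[OF assms(1)]
      unfolding P_def C\<^sub>1_def C\<^sub>2_def by (blast intro: polynomial_seq_if_fdiff_funpow_eq_0)
  qed

  \<comment> \<open>Subtracting the squared norms of the two parts, polynomial by nilpotency,
    isolates the cross term, to which \<open>unimodular_oscillation\<close> applies.\<close>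
  have cross: "Re (cinner ((T ^^ n) g\<^sub>1) ((T ^^ n) g\<^sub>2)) = 0"
    "z\<^sub>1 \<noteq> - z\<^sub>2 \<Longrightarrow> cinner ((T ^^ n) g\<^sub>1) ((T ^^ n) g\<^sub>2) = 0"
    if g: "g\<^sub>1 \<in> C\<^sub>1" "g\<^sub>2 \<in> C\<^sub>2" and P: "P (g\<^sub>1 + g\<^sub>2)" for g\<^sub>1 g\<^sub>2 n
  proof -
    define q where "q = (\<lambda>n. cinner ((T ^^ n) g\<^sub>1) ((T ^^ n) g\<^sub>2) / w ^ n)"
    have q: "cinner ((T ^^ n) g\<^sub>1) ((T ^^ n) g\<^sub>2) = w ^ n * q n" for n
      using w(1) by (auto simp: q_def)
    have "polynomial_seq q"
      using fdiff_funpow_cross_eq_0[OF assms(1) nz a[OF g(1)] b[OF g(2)]]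
      unfolding q_def w_def by (rule polynomial_seq_if_fdiff_funpow_eq_0)
    moreover have "polynomial_seq (\<lambda>n. complex_of_real ((norm ((T ^^ n) (g\<^sub>1 + g\<^sub>2)))\<^sup>2)
        - (of_real ((norm ((T ^^ n) g\<^sub>1))\<^sup>2) + of_real ((norm ((T ^^ n) g\<^sub>2))\<^sup>2)))"
      by (intro polynomial_seq_minus polynomial_seq_add P[unfolded P_def]
          polynomial_seq_if_fdiff_funpow_eq_0[OF norm1[OF g(1)]]
          polynomial_seq_if_fdiff_funpow_eq_0[OF norm2[OF g(2)]])
    then have "polynomial_seq (\<lambda>n. w ^ n * q n + cnj (w ^ n * q n))"
      unfolding expand q by simp
    ultimately show "Re (cinner ((T ^^ n) g\<^sub>1) ((T ^^ n) g\<^sub>2)) = 0"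
      "z\<^sub>1 \<noteq> - z\<^sub>2 \<Longrightarrow> cinner ((T ^^ n) g\<^sub>1) ((T ^^ n) g\<^sub>2) = 0"
      using unimodular_oscillation[OF w(1,2)] w(3) unfolding q by auto
  qed

  have orth: "corthogonal C\<^sub>1 C\<^sub>2"
    if forward: "\<And>n j. cinner ((T ^^ n) ((T ^^ j) h\<^sub>1)) ((T ^^ n) h\<^sub>2) = 0"
    unfolding C\<^sub>1_def C\<^sub>2_def cyclic_space_def
  proof (rule corthogonal_cspan, clarsimp)
    \<comment> \<open>The hypothesis covers only exponents \<open>m \<ge> n\<close>; polynomiality of \<open>g\<close> extends it to \<open>m < n\<close>.\<close>
    fix m n
    define g where "g = (\<lambda>k. cinner ((T ^^ k) h\<^sub>1) ((T ^^ n) h\<^sub>2) / z\<^sub>1 ^ k)"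
    have "((\<lambda>x. T x - z\<^sub>1 *\<^sub>C x) ^^ a) h\<^sub>1 = 0"
      by (rule a) (simp add: C\<^sub>1_def cyclic_space_self)
    from fdiff_funpow_orbit_eq_0[OF assms(1) nz(1) this] have "polynomial_seq g"
      unfolding g_def by (rule polynomial_seq_if_fdiff_funpow_eq_0)
    then obtain p where p: "\<And>k. g k = poly p (of_nat k)"
      unfolding polynomial_seq_def by blast
    have "g k = 0" if "k \<ge> n" for k
      using forward[of n "k - n"] that
      by (simp add: g_def funpow_add[symmetric, unfolded comp_def fun_eq_iff])
    then have "p = 0"
      by (intro poly_eq_0_if_eventually_zero[of n]) (simp add: p[symmetric])
    then have "g m = 0"
      by (simp add: p)
    with nz(1) show "cinner ((T ^^ m) h\<^sub>1) ((T ^^ n) h\<^sub>2) = 0"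
      by (simp add: g_def)
  qed

  have h: "h\<^sub>2 \<in> C\<^sub>2" "\<epsilon> *\<^sub>C (T ^^ j) h\<^sub>1 \<in> C\<^sub>1" "(T ^^ j) h\<^sub>1 \<in> C\<^sub>1" for \<epsilon> j
    by (simp_all add: C\<^sub>1_def C\<^sub>2_def cyclic_space_self cyclic_space_orbit cyclic_space_scaleC_orbit)

  let ?ii = "(z\<^sub>1 = - z\<^sub>2 \<and>
        (\<exists>\<epsilon>\<^sub>1\<in>{-1, 1}. \<exists>\<epsilon>\<^sub>2\<in>{-\<i>, \<i>}. \<forall>\<epsilon>\<in>{\<epsilon>\<^sub>1, \<epsilon>\<^sub>2}. \<forall>j. P (\<epsilon> *\<^sub>C (T ^^ j) h\<^sub>1 + h\<^sub>2))) \<or>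
      (z\<^sub>1 \<noteq> - z\<^sub>2 \<and> (\<forall>j. P ((T ^^ j) h\<^sub>1 + h\<^sub>2)))"

  have ii_orth: "corthogonal C\<^sub>1 C\<^sub>2" if ?ii
    using that
  proof (elim disjE conjE bexE)
    fix \<epsilon>\<^sub>1 \<epsilon>\<^sub>2
    assume eps: "\<epsilon>\<^sub>1 \<in> {-1, 1}" "\<epsilon>\<^sub>2 \<in> {-\<i>, \<i>}"
      and P: "\<forall>\<epsilon>\<in>{\<epsilon>\<^sub>1, \<epsilon>\<^sub>2}. \<forall>j. P (\<epsilon> *\<^sub>C (T ^^ j) h\<^sub>1 + h\<^sub>2)"
    \<comment> \<open>The factor leaves the inner product by linearity; the real unit then isolates
      the real part and the imaginary unit the imaginary part.\<close>
    have "Re (\<epsilon> * cinner ((T ^^ n) ((T ^^ j) h\<^sub>1)) ((T ^^ n) h\<^sub>2)) = 0" if "\<epsilon> \<in> {\<epsilon>\<^sub>1, \<epsilon>\<^sub>2}" for \<epsilon> n j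
      using cross(1)[OF h(2,1), of \<epsilon> j n] P that by (simp only: funpow_scaleC[OF assms(1)] cinner_scaleC_left)
    from this[of \<epsilon>\<^sub>1] this[of \<epsilon>\<^sub>2] eps show ?thesis
      by (intro orth) (auto simp: complex_eq_iff)
  next
    assume "z\<^sub>1 \<noteq> - z\<^sub>2" and "\<forall>j. P ((T ^^ j) h\<^sub>1 + h\<^sub>2)"
    then show ?thesis
      by (intro orth cross(2) h) auto
  qed
  \<comment> \<open>All scaled orbit vectors lie in \<open>C\<^sub>1\<close>, so any choice of signs
    works.\<close>
  have iii_ii: ?ii if "\<forall>g\<^sub>1\<in>C\<^sub>1. P (g\<^sub>1 + h\<^sub>2)"
    using that h by blast
  have iv_iii: "\<forall>g\<^sub>1\<in>C\<^sub>1. P (g\<^sub>1 + h\<^sub>2)" if "\<forall>g\<^sub>1\<in>C\<^sub>1. \<forall>g\<^sub>2\<in>C\<^sub>2. P (g\<^sub>1 + g\<^sub>2)"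
    using that h by blast
  \<comment> \<open>The implications form the cycle (i), (v), (iv), (iii), (ii), (i).\<close>
  have "(corthogonal C\<^sub>1 C\<^sub>2 \<longleftrightarrow> ?ii)
    \<and> (corthogonal C\<^sub>1 C\<^sub>2 \<longleftrightarrow> (\<forall>g\<^sub>1\<in>C\<^sub>1. P (g\<^sub>1 + h\<^sub>2)))
    \<and> (corthogonal C\<^sub>1 C\<^sub>2 \<longleftrightarrow> (\<forall>g\<^sub>1\<in>C\<^sub>1. \<forall>g\<^sub>2\<in>C\<^sub>2. P (g\<^sub>1 + g\<^sub>2)))
    \<and> (corthogonal C\<^sub>1 C\<^sub>2 \<longleftrightarrow> (\<exists>m\<ge>1. m_isometry_on m (C\<^sub>1 + C\<^sub>2) T))"
    using orth_isometry isometry_all iv_iii iii_ii ii_orth by argo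
  then show ?thesis
    unfolding C\<^sub>1_def C\<^sub>2_def P_def .
qed

end
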